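(* Let $[a,b]\subseteq\mathbb{R}$, $n\ge1$, and let $L\colon[a,b]\times\mathbb{R}^n\times\mathbb{R}^n\to\mathbb{R}$ be continuous. Let $v\in W^{1,1}((a,b);\mathbb{R}^n)$ be such that $t\mapsto L(t,v(t),v'(t))$ is integrable on $[a,b]$, let $U\subseteq(a,b)$ be open and non-empty, and let $\epsilon>0$. Then there exists $u\in\mathscr{A}_{v(a),v(b)}$ such that \[ \emptyset\ne\{t\in[a,b]:u(t)\ne v(t)\}\subseteq U\quad\text{and}\quad|\mathscr{L}(u)-\mathscr{L}(v)|\le\epsilon . \]
   Context: Functions in $W^{1,1}((a,b);\mathbb{R}^n)$ are identified with their absolutely continuous representatives on $[a,b]$. $\mathscr{L}(u)=\int_a^b L(t,u(t),u'(t))\,dt$ and, for $A,B\in\mathbb{R}^n$, $\mathscr{A}_{A,B}=\{u\in W^{1,1}((a,b);\mathbb{R}^n):u(a)=A,\ u(b)=B\}$. *)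

theory Defs
  imports "HOL-Analysis.Analysis"
begin

text \<open>The space of test functions, usually written \<open>C\<^sub>c\<^sup>\<infinity>(a, b)\<close>.\<close>

definition test_function :: "real \<Rightarrow> real \<Rightarrow> (real \<Rightarrow> real) \<Rightarrow> bool" where
  "test_function a b \<phi> \<longleftrightarrow>
     (\<forall>k. (deriv ^^ k) \<phi> differentiable_on UNIV) \<and>
     compact (closure {t. \<phi> t \<noteq> 0}) \<and> closure {t. \<phi> t \<noteq> 0} \<subseteq> {a<..<b}"

definition is_weak_derivative ::
    "real \<Rightarrow> real \<Rightarrow> (real \<Rightarrow> 'a::euclidean_space) \<Rightarrow> (real \<Rightarrow> 'a) \<Rightarrow> bool" where
  "is_weak_derivative a b u g \<longleftrightarrow>
     g absolutely_integrable_on {a<..<b} \<and>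
     (\<forall>\<phi>. test_function a b \<phi> \<longrightarrow>
        set_lebesgue_integral lebesgue {a<..<b} (\<lambda>t. deriv \<phi> t *\<^sub>R u t) =
        - set_lebesgue_integral lebesgue {a<..<b} (\<lambda>t. \<phi> t *\<^sub>R g t))"

text \<open>A weak derivative is unique up to Lebesgue-null sets, so the choice below affects neither
  the integrability of \<open>t \<mapsto> L (t, u t, weak_deriv a b u t)\<close> nor its integral.\<close>

definition weak_deriv ::
    "real \<Rightarrow> real \<Rightarrow> (real \<Rightarrow> 'a::euclidean_space) \<Rightarrow> real \<Rightarrow> 'a" where
  "weak_deriv a b u = (SOME g. is_weak_derivative a b u g)"

text \<open>Degenerate intervals \<open>(c, c)\<close> are harmless: they contribute \<open>0\<close> to both sums.\<close>

definition abs_continuous_interval ::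
    "real \<Rightarrow> real \<Rightarrow> (real \<Rightarrow> 'a::real_normed_vector) \<Rightarrow> bool" where
  "abs_continuous_interval a b u \<longleftrightarrow>
     (\<forall>\<epsilon>>0. \<exists>\<delta>>0. \<forall>D. finite D \<longrightarrow> (\<forall>(c, d)\<in>D. a \<le> c \<and> c \<le> d \<and> d \<le> b) \<longrightarrow>
        disjoint_family_on (\<lambda>(c, d). {c<..<d}) D \<longrightarrow>
        (\<Sum>(c, d)\<in>D. d - c) < \<delta> \<longrightarrow> (\<Sum>(c, d)\<in>D. norm (u d - u c)) < \<epsilon>)"

text \<open>The elements of \<open>W\<^sup>1\<^sup>,\<^sup>1((a, b))\<close>, each given by its absolutely continuous representative
  on \<open>[a, b]\<close>. Values outside \<open>[a, b]\<close> play no role.\<close>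

definition W11 :: "real \<Rightarrow> real \<Rightarrow> (real \<Rightarrow> 'a::euclidean_space) set" where
  "W11 a b = {u. abs_continuous_interval a b u \<and>
                 u absolutely_integrable_on {a<..<b} \<and> (\<exists>g. is_weak_derivative a b u g)}"

definition admissible ::
    "real \<Rightarrow> real \<Rightarrow> 'a::euclidean_space \<Rightarrow> 'a \<Rightarrow> (real \<Rightarrow> 'a) set" where
  "admissible a b A B = {u \<in> W11 a b. u a = A \<and> u b = B}"

definition lagrangian ::
    "(real \<times> 'a \<times> 'a \<Rightarrow> real) \<Rightarrow> real \<Rightarrow> real \<Rightarrow> (real \<Rightarrow> 'a::euclidean_space) \<Rightarrow> real \<Rightarrow> real"
  where "lagrangian L a b u t = L (t, u t, weak_deriv a b u t)"

definition action ::
    "(real \<times> 'a \<times> 'a \<Rightarrow> real) \<Rightarrow> real \<Rightarrow> real \<Rightarrow> (real \<Rightarrow> 'a::euclidean_space) \<Rightarrow> real"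
  where "action L a b u = set_lebesgue_integral lebesgue {a..b} (lagrangian L a b u)"

end

theory Submission
  imports Defs
begin

text \<open>
  The perturbation need not be a bump added to \<open>v\<close>: where \<open>v'\<close> is unbounded, adding even a tiny
  bump could change \<open>L (t, v, v')\<close> uncontrollably. Instead \<open>v\<close> is replaced outright on a short interval
  \<open>[c, d] \<subseteq> U\<close> by a smooth curve \<open>p\<close> with the same endpoint values. The new action on \<open>[c, d]\<close> is at
  most \<open>M * (d - c)\<close> as long as \<open>p\<close> and \<open>p'\<close> stay in a fixed bounded set, on which \<open>\<bar>L\<bar> \<le> M\<close>; the old
  action on \<open>[c, d]\<close> is small because the Lagrangian of \<open>v\<close> is integrable.

  What is needed is therefore a sequence of intervals, shrinking in length, on which the difference
  quotient of \<open>v\<close> stays bounded. Pigeonhole supplies it: cut a fixed \<open>[\<alpha>, \<beta>] \<subseteq> U\<close> into \<open>N\<close> equal parts. On one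
  of them the integral of \<open>\<bar>v'\<bar> + \<bar>L (t, v, v')\<bar>\<close> is at most \<open>1 / N\<close> of its total \<open>K\<close>
  (\<open>integral_equipartition_le_average\<close>). On that part the difference quotient is at most \<open>K / (\<beta> - \<alpha>)\<close>,
  whatever \<open>N\<close> is, and the old action is at most \<open>K / N\<close>. For \<open>p\<close> one takes the chord of
  \<open>v\<close>, or the chord plus a parabolic arch; these two disagree at the midpoint, so at least one of them
  disagrees with \<open>v\<close> there.

  The remaining work translates between weak derivatives, defined by test functions, and
  calculus on subintervals. Testing with \<open>\<phi>\<close> times a smooth approximation of the indicator of
  \<open>[c, d]\<close> yields integration by parts on \<open>[c, d]\<close> (\<open>weak_derivative_by_parts\<close>). From it follow
  \<open>v d - v c = \<integral> v'\<close>, the uniqueness of the weak derivative almost everywhere, and the weak derivative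
  of the curve after replacement (\<open>weak_derivative_replace_on\<close>).
\<close>

section \<open>Smooth functions and a smooth step\<close>

text \<open>Recursion on the order makes the closure properties below inductions in which the derivative is
  treated as a function of one order less; iterating \<open>deriv\<close> would require formulas for the iterates.\<close>

fun times_differentiable :: "nat \<Rightarrow> (real \<Rightarrow> real) \<Rightarrow> bool" where
  "times_differentiable 0 f \<longleftrightarrow> True"
| "times_differentiable (Suc n) f \<longleftrightarrow>
     (\<exists>f'. (\<forall>x. (f has_real_derivative f' x) (at x)) \<and> times_differentiable n f')"

definition smooth :: "(real \<Rightarrow> real) \<Rightarrow> bool" where
  "smooth f \<longleftrightarrow> (\<forall>n. times_differentiable n f)"

lemma times_differentiable_SucD: "times_differentiable (Suc n) f \<Longrightarrow> times_differentiable n f"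
proof (induction n arbitrary: f)
  case (Suc n)
  then obtain f' where "\<forall>x. (f has_real_derivative f' x) (at x)" "times_differentiable (Suc n) f'"
    by (meson times_differentiable.simps(2))
  with Suc.IH[of f'] show ?case by auto
qed simp

lemma times_differentiable_add:
  "times_differentiable n f \<Longrightarrow> times_differentiable n g \<Longrightarrow> times_differentiable n (\<lambda>x. f x + g x)"
proof (induction n arbitrary: f g)
  case (Suc n)
  then obtain f' g' where
    "\<forall>x. (f has_real_derivative f' x) (at x)" "times_differentiable n f'"
    "\<forall>x. (g has_real_derivative g' x) (at x)" "times_differentiable n g'" by auto
  with Suc.IH[of f' g'] show ?case
    by (auto intro!: exI[of _ "\<lambda>x. f' x + g' x"] derivative_eq_intros)
qed simp

lemma times_differentiable_mult:
  "times_differentiable n f \<Longrightarrow> times_differentiable n g \<Longrightarrow> times_differentiable n (\<lambda>x. f x * g x)"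
proof (induction n arbitrary: f g)
  case (Suc n)
  have f: "times_differentiable n f" and g: "times_differentiable n g"
    using Suc.prems times_differentiable_SucD by auto
  obtain f' g' where f': "\<forall>x. (f has_real_derivative f' x) (at x)" "times_differentiable n f'"
    and g': "\<forall>x. (g has_real_derivative g' x) (at x)" "times_differentiable n g'"
    using Suc.prems by auto
  have "times_differentiable n (\<lambda>x. f' x * g x + f x * g' x)"
    using Suc.IH f g f' g' by (intro times_differentiable_add) auto
  with f' g' show ?case
    by (auto intro!: exI[of _ "\<lambda>x. f' x * g x + f x * g' x"] derivative_eq_intros)
qed simp

lemma times_differentiable_const: "times_differentiable n (\<lambda>x. c)"
  by (induction n arbitrary: c) (auto intro!: exI[of _ "\<lambda>x. 0"])

lemma times_differentiable_inverse:
  assumes "\<And>x. f x \<noteq> 0" "times_differentiable n f"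
  shows "times_differentiable n (\<lambda>x. inverse (f x))"
  using assms(2)
proof (induction n)
  case (Suc n)
  then obtain f' where f': "\<forall>x. (f has_real_derivative f' x) (at x)" "times_differentiable n f'"
    by auto
  have "times_differentiable n (\<lambda>x. inverse (f x))"
    using Suc times_differentiable_SucD by blast
  then have "times_differentiable n (\<lambda>x. (- 1) * (inverse (f x) * f' x * inverse (f x)))"
    using f' by (intro times_differentiable_mult times_differentiable_const)
  with f' assms(1) show ?case
    by (auto intro!: exI[of _ "\<lambda>x. (- 1) * (inverse (f x) * f' x * inverse (f x))"] derivative_eq_intros)
qed simp

lemma times_differentiable_compose_affine:
  "times_differentiable n f \<Longrightarrow> times_differentiable n (\<lambda>x. f (k * x + m))"
proof (induction n arbitrary: f)
  case (Suc n)
  then obtain f' where f': "\<forall>x. (f has_real_derivative f' x) (at x)" "times_differentiable n f'"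
    by auto
  have "times_differentiable n (\<lambda>x. f' (k * x + m) * k)"
    using Suc.IH f' by (intro times_differentiable_mult times_differentiable_const) auto
  moreover have "((\<lambda>x. f (k * x + m)) has_real_derivative f' (k * x + m) * k) (at x)" for x
    using f'(1) by (intro DERIV_chain2[of f "f' (k * x + m)"]) (auto intro!: derivative_eq_intros)
  ultimately show ?case by (auto intro!: exI[of _ "\<lambda>x. f' (k * x + m) * k"])
qed simp

lemma times_differentiable_iff_deriv:
  "times_differentiable n f \<longleftrightarrow> (\<forall>k<n. (deriv ^^ k) f differentiable_on UNIV)"
proof (induction n arbitrary: f)
  case (Suc n)
  have "times_differentiable (Suc n) f \<longleftrightarrow> f differentiable_on UNIV \<and> times_differentiable n (deriv f)"
  proof
    assume "times_differentiable (Suc n) f"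
    then obtain f' where f': "\<forall>x. (f has_real_derivative f' x) (at x)" "times_differentiable n f'"
      by auto
    then have "f' = deriv f" by (metis DERIV_imp_deriv ext)
    with f' show "f differentiable_on UNIV \<and> times_differentiable n (deriv f)"
      by (auto simp: differentiable_on_def real_differentiable_def)
  next
    assume "f differentiable_on UNIV \<and> times_differentiable n (deriv f)"
    then show "times_differentiable (Suc n) f"
      by (auto simp: differentiable_on_def real_differentiable_def DERIV_imp_deriv intro!: exI[of _ "deriv f"]) (metis DERIV_imp_deriv)
  qed
  also have "\<dots> \<longleftrightarrow> f differentiable_on UNIV \<and> (\<forall>k<n. (deriv ^^ Suc k) f differentiable_on UNIV)"
    by (simp only: Suc.IH funpow_Suc_right o_apply)
  also have "\<dots> \<longleftrightarrow> (\<forall>k<Suc n. (deriv ^^ k) f differentiable_on UNIV)"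
    by (auto simp: less_Suc_eq_0_disj)
  finally show ?case .
qed simp

lemma smooth_iff_deriv: "smooth f \<longleftrightarrow> (\<forall>k. (deriv ^^ k) f differentiable_on UNIV)"
  unfolding smooth_def times_differentiable_iff_deriv by blast

lemma smooth_deriv:
  assumes "smooth f"
  shows "(f has_real_derivative deriv f x) (at x)" and "smooth (deriv f)"
proof -
  show "(f has_real_derivative deriv f x) (at x)"
    using assms[unfolded smooth_iff_deriv, rule_format, of 0]
    by (auto simp: differentiable_on_def real_differentiable_def) (metis DERIV_imp_deriv)
  show "smooth (deriv f)"
    using assms[unfolded smooth_iff_deriv, rule_format, of "Suc _"]
    by (simp add: smooth_iff_deriv funpow_Suc_right del: funpow.simps)
qed

lemma smooth_continuous: "smooth f \<Longrightarrow> continuous_on S f"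
  by (meson smooth_deriv(1) DERIV_isCont continuous_at_imp_continuous_on)

lemma smooth_intros:
  "smooth (\<lambda>x. c)"
  "smooth f \<Longrightarrow> smooth g \<Longrightarrow> smooth (\<lambda>x. f x + g x)"
  "smooth f \<Longrightarrow> smooth g \<Longrightarrow> smooth (\<lambda>x. f x * g x)"
  "smooth f \<Longrightarrow> smooth (\<lambda>x. f (k * x + m))"
  "(\<And>x. f x \<noteq> 0) \<Longrightarrow> smooth f \<Longrightarrow> smooth (\<lambda>x. inverse (f x))"
  by (auto simp: smooth_def times_differentiable_const times_differentiable_add
      times_differentiable_mult times_differentiable_compose_affine times_differentiable_inverse)

text \<open>The functions \<open>p (1 / x) * exp (- 1 / x)\<close> extended by zero to \<open>x \<le> 0\<close>. Letting \<open>p\<close> range over all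
  polynomials gives a family closed under differentiation, so one derivative computation proves
  smoothness.\<close>

definition flat_exp :: "real poly \<Rightarrow> real \<Rightarrow> real" where
  "flat_exp p x = (if x > 0 then poly p (inverse x) * exp (- inverse x) else 0)"

lemma poly_times_exp_minus_tendsto_0: "((\<lambda>y. poly p y * exp (- y)) \<longlongrightarrow> (0::real)) at_top"
proof -
  have "((\<lambda>y. \<Sum>i\<le>degree p. coeff p i * (y ^ i / exp y)) \<longlongrightarrow> (\<Sum>i\<le>degree p. coeff p i * 0)) at_top"
    by (intro tendsto_intros tendsto_power_div_exp_0)
  then show ?thesis
    by (simp add: poly_altdef sum_distrib_right exp_minus divide_inverse mult.assoc)
qed

lemma flat_exp_has_derivative:
  "(flat_exp p has_real_derivative flat_exp (monom 1 2 * (p - pderiv p)) x) (at x)"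
proof -
  consider "x > 0" | "x < 0" | "x = 0" by linarith
  then show ?thesis
  proof cases
    case 1
    have "((\<lambda>x. poly p (inverse x) * exp (- inverse x)) has_real_derivative
        flat_exp (monom 1 2 * (p - pderiv p)) x) (at x)"
      using 1 by (auto intro!: derivative_eq_intros
          simp: flat_exp_def poly_monom field_simps power2_eq_square)
    moreover have ev: "\<forall>\<^sub>F y in nhds x. flat_exp p y = poly p (inverse y) * exp (- inverse y)"
      using eventually_nhds_in_open[of "{0<..}" x] 1 by (auto simp: flat_exp_def elim!: eventually_mono)
    ultimately show ?thesis by (simp add: DERIV_cong_ev[OF refl ev refl])
  next
    case 2
    have "((\<lambda>x. 0) has_real_derivative flat_exp (monom 1 2 * (p - pderiv p)) x) (at x)"
      using 2 by (simp add: flat_exp_def)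
    moreover have ev: "\<forall>\<^sub>F y in nhds x. flat_exp p y = 0"
      using eventually_nhds_in_open[of "{..<0}" x] 2 by (auto simp: flat_exp_def elim!: eventually_mono)
    ultimately show ?thesis by (simp add: DERIV_cong_ev[OF refl ev refl])
  next
    case 3
    \<comment> \<open>The difference quotient at 0 from the right is a polynomial in \<open>1 / y\<close> times \<open>exp (- 1 / y)\<close>.\<close>
    have "((\<lambda>y. poly (pCons 0 p) (inverse y) * exp (- inverse y)) \<longlongrightarrow> 0) (at_right 0)"
      using filterlim_compose[OF poly_times_exp_minus_tendsto_0 filterlim_inverse_at_top_right] .
    then have "((\<lambda>y. (flat_exp p (0 + y) - flat_exp p 0) / y) \<longlongrightarrow> 0) (at_right 0)"
      by (rule tendsto_cong[THEN iffD1, rotated])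
        (auto simp: flat_exp_def eventually_at_filter divide_inverse mult_ac)
    moreover have "((\<lambda>y. (flat_exp p (0 + y) - flat_exp p 0) / y) \<longlongrightarrow> 0) (at_left 0)"
      by (rule tendsto_eventually) (auto simp: flat_exp_def eventually_at_filter)
    ultimately show ?thesis
      using 3 by (simp add: DERIV_def filterlim_split_at flat_exp_def)
  qed
qed

lemma smooth_flat_exp: "smooth (flat_exp p)"
proof -
  have "times_differentiable n (flat_exp p)" for n
    by (induction n arbitrary: p) (auto intro: flat_exp_has_derivative)
  then show ?thesis by (simp add: smooth_def)
qed

text \<open>With \<open>f\<close> the flat exponential, \<open>f x / (f x + f (1 - x))\<close> works: at every point at least one of
  the two summands in the denominator is positive.\<close>

lemma smooth_step_exists:
  obtains H :: "real \<Rightarrow> real" where "smooth H" "\<And>x. x \<le> 0 \<Longrightarrow> H x = 0" "\<And>x. x \<ge> 1 \<Longrightarrow> H x = 1"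
    "\<And>x. 0 \<le> H x" "\<And>x. H x \<le> 1"
proof
  let ?f = "flat_exp 1"
  define H where "H = (\<lambda>x. ?f x * inverse (?f x + ?f ((- 1) * x + 1)))"
  have pos: "?f x + ?f ((- 1) * x + 1) > 0" for x
    by (auto simp: flat_exp_def add_pos_pos)
  have nonneg: "?f x \<ge> 0" for x by (simp add: flat_exp_def)
  show "smooth H"
    unfolding H_def using pos by (intro smooth_intros smooth_flat_exp) (metis less_irrefl)
  show "H x = 0" if "x \<le> 0" for x using that by (simp add: H_def flat_exp_def)
  show "H x = 1" if "x \<ge> 1" for x using that by (simp add: H_def flat_exp_def)
  show "0 \<le> H x" "H x \<le> 1" for x
    using pos[of x] nonneg[of x] nonneg[of "(-1) * x + 1"] by (auto simp: H_def field_simps)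
qed

section \<open>Integration by parts against a weak derivative\<close>

lemma smooth_compose_scaled_shift:
  assumes "smooth H" shows "smooth (\<lambda>t. H (k * (t - c)))"
  using smooth_intros(4)[OF assms, of k "- (k * c)"] by (simp add: algebra_simps)

lemma deriv_compose_scaled_shift:
  assumes "smooth H"
  shows "((\<lambda>t. H (k * (t - c))) has_real_derivative k * deriv H (k * (t - c))) (at t)"
proof -
  have "((\<lambda>t. H (k * (t - c))) has_real_derivative deriv H (k * (t - c)) * k) (at t)"
    by (rule DERIV_chain2[OF smooth_deriv(1)[OF assms]]) (auto intro!: derivative_eq_intros)
  then show ?thesis by (simp add: mult.commute)
qed

lemma deriv_step_eq_0:
  assumes "\<And>x. x \<le> 0 \<Longrightarrow> H x = 0" "\<And>x. x \<ge> 1 \<Longrightarrow> H x = (1::real)" and x: "x < 0 \<or> x > 1"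
  shows "deriv H x = 0"
proof -
  obtain m where "\<forall>\<^sub>F y in nhds x. H y = m"
  proof (cases "x < 0")
    case True
    then have "\<forall>\<^sub>F y in nhds x. H y = 0"
      using eventually_nhds_in_open[of "{..<0}" x] assms(1) by (auto elim!: eventually_mono)
    then show ?thesis using that by blast
  next
    case False
    then have "\<forall>\<^sub>F y in nhds x. H y = 1"
      using eventually_nhds_in_open[of "{1<..}" x] assms(2) x by (auto elim!: eventually_mono)
    then show ?thesis using that by blast
  qed
  then have "(H has_real_derivative 0) (at x)"
    by (simp add: DERIV_cong_ev[OF refl _ refl])
  then show ?thesis by (rule DERIV_imp_deriv)
qed

text \<open>The functions \<open>k * H' (k * (t - c))\<close> are supported in \<open>[c, c + 1 / k]\<close> and have integral
  \<open>H 1 - H 0 = 1\<close>, so they form an approximate identity from the right at \<open>c\<close>. They may change sign,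
  but their \<open>L\<^sup>1\<close> norms are bounded by the maximum of \<open>\<bar>H'\<bar>\<close> on \<open>[0, 1]\<close>.\<close>

lemma step_derivative_concentrates:
  fixes w :: "real \<Rightarrow> 'a::euclidean_space"
  assumes H: "smooth H" "\<And>x. x \<le> 0 \<Longrightarrow> H x = 0" "\<And>x. x \<ge> 1 \<Longrightarrow> H x = 1"
    and w: "continuous_on {a..b} w" and c: "a \<le> c" "c < b"
  shows "(\<lambda>k. integral {a..b} (\<lambda>t. (real k * deriv H (real k * (t - c))) *\<^sub>R w t)) \<longlonglongrightarrow> w c"
proof (rule LIMSEQ_I)
  fix e :: real assume "e > 0"
  have "compact (deriv H ` {0..1})"
    using smooth_continuous[OF smooth_deriv(2)[OF H(1)]] by (intro compact_continuous_image) auto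
  then obtain C where C: "C > 0" "\<And>x. x \<in> {0..1} \<Longrightarrow> \<bar>deriv H x\<bar> \<le> C"
    by (metis bounded_pos compact_imp_bounded imageI real_norm_def)
  have "e / (2 * C) > 0" using \<open>e > 0\<close> C by simp
  then obtain \<delta> where \<delta>: "\<delta> > 0" "\<And>t. t \<in> {a..b} \<Longrightarrow> dist t c < \<delta> \<Longrightarrow> dist (w t) (w c) < e / (2 * C)"
    using w c unfolding continuous_on_iff by (metis atLeastAtMost_iff less_imp_le)
  obtain K :: nat where K: "real K > max (1 / \<delta>) (1 / (b - c))"
    using reals_Archimedean2 by blast
  have Kpos: "real K > 0" using K \<delta> by (metis divide_pos_pos less_trans max_less_iff_conj zero_less_one)
  show "\<exists>K. \<forall>k\<ge>K. norm (integral {a..b} (\<lambda>t. (real k * deriv H (real k * (t - c))) *\<^sub>R w t) - w c) < e"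
  proof (intro exI allI impI)
    fix k assume "k \<ge> K"
    define r where "r = real k"
    have r: "r > 0" "1 / r < \<delta>" "1 / r < b - c"
    proof -
      have "r > max (1 / \<delta>) (1 / (b - c))" using K \<open>k \<ge> K\<close> by (simp add: r_def)
      moreover show "r > 0" using Kpos \<open>k \<ge> K\<close> by (simp add: r_def)
      ultimately show "1 / r < \<delta>" "1 / r < b - c"
        using \<delta>(1) c by (auto simp: field_simps)
    qed
    let ?J = "{c..c + 1 / r}"
    let ?\<rho> = "\<lambda>t. r * deriv H (r * (t - c))"
    have cont: "continuous_on S ?\<rho>" for S
      by (intro continuous_intros smooth_continuous[OF smooth_compose_scaled_shift] smooth_deriv H)
    have sub: "?J \<subseteq> {a..b}" using r c by auto
    have out: "?\<rho> t = 0" if "t \<notin> ?J" for t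
    proof -
      have "r * (t - c) < 0 \<or> r * (t - c) > 1"
        using that r(1) by (auto simp: field_simps mult_less_0_iff)
      then show ?thesis using deriv_step_eq_0[OF H(2,3)] by simp
    qed
    have "(?\<rho> has_integral H (r * (c + 1 / r - c)) - H (r * (c - c))) ?J"
      using r(1) deriv_compose_scaled_shift[OF H(1)]
      by (intro fundamental_theorem_of_calculus)
        (auto simp flip: has_real_derivative_iff_has_vector_derivative intro: has_field_derivative_at_within)
    then have one: "(?\<rho> has_integral 1) ?J" using H r(1) by simp
    have J: "((\<lambda>t. ?\<rho> t *\<^sub>R w t) has_integral integral ?J (\<lambda>t. ?\<rho> t *\<^sub>R w t)) ?J"
      using continuous_on_subset[OF w sub]
      by (intro integrable_integral integrable_continuous_real continuous_intros cont)
    have "((\<lambda>t. ?\<rho> t *\<^sub>R w t) has_integral integral ?J (\<lambda>t. ?\<rho> t *\<^sub>R w t)) {a..b}"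
      by (rule has_integral_on_superset[OF J _ sub]) (use out in simp)
    then have eq: "integral {a..b} (\<lambda>t. ?\<rho> t *\<^sub>R w t) = integral ?J (\<lambda>t. ?\<rho> t *\<^sub>R w t)"
      by (rule integral_unique)
    have diff: "((\<lambda>t. ?\<rho> t *\<^sub>R w t - ?\<rho> t *\<^sub>R w c) has_integral
        integral ?J (\<lambda>t. ?\<rho> t *\<^sub>R w t) - 1 *\<^sub>R w c) ?J"
      by (intro has_integral_diff J has_integral_scaleR_left one)
    have "norm (integral ?J (\<lambda>t. ?\<rho> t *\<^sub>R w t) - 1 *\<^sub>R w c) \<le> (r * C * (e / (2 * C))) * measure lborel ?J"
    proof (rule has_integral_bound_real[OF _ _ diff])
      show "finite ({} :: real set)" by simp
      show "0 \<le> r * C * (e / (2 * C))" using r C \<open>e > 0\<close> by simp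
      fix t assume t: "t \<in> ?J - {}"
      have "r * (t - c) \<in> {0..1}" using t r(1) by (auto simp: field_simps)
      then have "\<bar>?\<rho> t\<bar> \<le> r * C" using C(2) r(1) by (simp add: abs_mult)
      moreover have "norm (w t - w c) \<le> e / (2 * C)"
      proof -
        have "t \<in> {a..b}" using t sub by blast
        moreover have "dist t c < \<delta>" using t r(2) by (auto simp: dist_real_def)
        ultimately show ?thesis using \<delta>(2)[of t] by (simp add: dist_norm)
      qed
      ultimately have "\<bar>?\<rho> t\<bar> * norm (w t - w c) \<le> r * C * (e / (2 * C))"
        by (intro mult_mono) auto
      then show "norm (?\<rho> t *\<^sub>R w t - ?\<rho> t *\<^sub>R w c) \<le> r * C * (e / (2 * C))"
        by (simp flip: scaleR_diff_right)
    qed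
    also have "\<dots> < e" using r C \<open>e > 0\<close> by simp
    finally show "norm (integral {a..b} (\<lambda>t. (real k * deriv H (real k * (t - c))) *\<^sub>R w t) - w c) < e"
      using eq by (simp add: r_def)
  qed
qed

lemma absolutely_integrable_continuous_scaleR:
  fixes g :: "real \<Rightarrow> 'a::euclidean_space"
  assumes "continuous_on {a..b} f" "g absolutely_integrable_on {a..b}"
  shows "(\<lambda>t. f t *\<^sub>R g t) absolutely_integrable_on {a..b}"
proof (rule absolutely_integrable_bounded_measurable_product[of "(*\<^sub>R)", OF _ _ _ _ assms(2)])
  show "bilinear ((*\<^sub>R) :: real \<Rightarrow> 'a \<Rightarrow> 'a)"
    by (simp add: bilinear_conv_bounded_bilinear bounded_bilinear_scaleR)
  show "f \<in> borel_measurable (lebesgue_on {a..b})"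
    using assms(1) by (intro continuous_imp_measurable_on_sets_lebesgue) auto
  show "bounded (f ` {a..b})"
    using assms(1) by (intro compact_imp_bounded compact_continuous_image) auto
qed auto

lemma absolutely_integrable_on_open_interval_iff:
  fixes g :: "real \<Rightarrow> 'a::euclidean_space"
  shows "g absolutely_integrable_on {a<..<b} \<longleftrightarrow> g absolutely_integrable_on {a..b}"
proof (rule absolutely_integrable_spike_set_eq)
  show "negligible {x \<in> {a<..<b} - {a..b}. g x \<noteq> 0}" by (rule negligible_subset[of "{}"]) auto
  show "negligible {x \<in> {a..b} - {a<..<b}. g x \<noteq> 0}" by (rule negligible_subset[of "{a,b}"]) auto
qed

lemma set_lebesgue_integral_open_interval:
  fixes g :: "real \<Rightarrow> 'a::euclidean_space"
  assumes "g absolutely_integrable_on {a..b}"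
  shows "set_lebesgue_integral lebesgue {a<..<b} g = integral {a..b} g"
  using set_lebesgue_integral_eq_integral(2)[of "{a<..<b}" g] assms
  by (simp add: absolutely_integrable_on_open_interval_iff integral_open_interval_real)

text \<open>The test function is \<open>\<phi>\<close> times \<open>\<eta> k t = H (k * (t - c)) - H (k * (t - d))\<close>, whose limit is the
  indicator of \<open>(c, d]\<close>. Where the derivative falls on \<open>\<phi>\<close>, dominated convergence produces integrals
  over \<open>[c, d]\<close>; where it falls on \<open>\<eta>\<close>, two approximate identities produce the boundary terms.\<close>

lemma weak_derivative_by_parts:
  fixes v :: "real \<Rightarrow> 'a::euclidean_space"
  assumes wd: "is_weak_derivative a b v g" and v: "continuous_on {a..b} v"
    and \<phi>: "smooth \<phi>" and cd: "a < c" "c < d" "d < b"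
  shows "integral {c..d} (\<lambda>t. deriv \<phi> t *\<^sub>R v t) =
         \<phi> d *\<^sub>R v d - \<phi> c *\<^sub>R v c - integral {c..d} (\<lambda>t. \<phi> t *\<^sub>R g t)"
proof -
  obtain H :: "real \<Rightarrow> real" where H: "smooth H" "\<And>x. x \<le> 0 \<Longrightarrow> H x = 0" "\<And>x. x \<ge> 1 \<Longrightarrow> H x = 1"
    "\<And>x. 0 \<le> H x" "\<And>x. H x \<le> 1" using smooth_step_exists by metis
  have g: "g absolutely_integrable_on {a..b}"
    using wd by (simp add: is_weak_derivative_def absolutely_integrable_on_open_interval_iff)
  define \<eta> where "\<eta> = (\<lambda>(k::nat) t. H (real k * (t - c)) + (- 1) * H (real k * (t - d)))"
  define \<rho> where "\<rho> = (\<lambda>(k::nat) s t. real k * deriv H (real k * (t - s)))"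
  have \<eta>_smooth: "smooth (\<eta> k)" for k
    unfolding \<eta>_def by (intro smooth_intros smooth_compose_scaled_shift H)
  have \<eta>_bound: "\<bar>\<eta> k t\<bar> \<le> 1" for k t
    using H(4,5)[of "real k * (t - c)"] H(4,5)[of "real k * (t - d)"] by (auto simp: \<eta>_def abs_le_iff)
  have H_lim: "(\<lambda>k. H (real k * (t - s))) \<longlonglongrightarrow> (if s < t then 1 else 0)" for s t
  proof (cases "s < t")
    case True
    obtain K :: nat where "real K > 1 / (t - s)" using reals_Archimedean2 by blast
    then have "\<forall>k\<ge>K. H (real k * (t - s)) = 1"
      using True H(3) by (smt (verit) divide_less_eq mult.commute of_nat_le_iff mult_le_cancel_left)
    then show ?thesis using True by (auto intro!: tendsto_eventually eventually_sequentiallyI)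
  next
    case False
    then show ?thesis using H(2) by (auto simp: mult_nonneg_nonpos)
  qed
  have \<eta>_lim: "(\<lambda>k. \<eta> k t) \<longlonglongrightarrow> (if t \<in> {c<..d} then 1 else 0)" for t
    using tendsto_add[OF H_lim tendsto_mult_left[OF H_lim, of "-1"], of t c t d] cd
    by (auto simp: \<eta>_def split: if_splits)
  have lim: "(\<lambda>k. integral {a..b} (\<lambda>t. \<eta> k t *\<^sub>R f t)) \<longlonglongrightarrow> integral {c..d} f"
    if f: "f absolutely_integrable_on {a..b}" for f :: "real \<Rightarrow> 'a"
  proof -
    have "(\<lambda>k. integral {a..b} (\<lambda>t. \<eta> k t *\<^sub>R f t)) \<longlonglongrightarrow>
        integral {a..b} (\<lambda>t. (if t \<in> {c<..d} then 1 else 0) *\<^sub>R f t)"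
    proof (rule dominated_convergence(2))
      show "(\<lambda>t. \<eta> k t *\<^sub>R f t) integrable_on {a..b}" for k
        by (intro set_lebesgue_integral_eq_integral(1) absolutely_integrable_continuous_scaleR
            smooth_continuous \<eta>_smooth f)
      show "(\<lambda>t. norm (f t)) integrable_on {a..b}"
        using f absolutely_integrable_on_def by blast
      show "norm (\<eta> k t *\<^sub>R f t) \<le> norm (f t)" for k t
        using \<eta>_bound[of k t] by (simp add: mult_left_le_one_le)
      show "(\<lambda>k. \<eta> k t *\<^sub>R f t) \<longlonglongrightarrow> (if t \<in> {c<..d} then 1 else 0) *\<^sub>R f t" for t
        by (intro tendsto_intros \<eta>_lim)
    qed
    also have "integral {a..b} (\<lambda>t. (if t \<in> {c<..d} then 1 else 0) *\<^sub>R f t) =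
        integral {a..b} (\<lambda>t. if t \<in> {c..d} then f t else 0)"
      by (rule integral_spike[of "{c}"]) auto
    also have "\<dots> = integral {c..d} f"
    proof -
      have "{c..d} \<inter> {a..b} = {c..d}" using cd by auto
      then show ?thesis by (simp only: integral_restrict_Int)
    qed
    finally show ?thesis .
  qed
  have \<phi>v: "continuous_on {a..b} (\<lambda>t. \<phi> t *\<^sub>R v t)" "continuous_on {a..b} (\<lambda>t. deriv \<phi> t *\<^sub>R v t)"
    by (intro continuous_intros smooth_continuous smooth_deriv \<phi> v)+
  have \<rho>_cont: "continuous_on S (\<rho> k s)" for S k s
    unfolding \<rho>_def
    by (intro continuous_intros smooth_continuous[OF smooth_compose_scaled_shift] smooth_deriv H)
  have L: "(\<lambda>k. integral {a..b} (\<lambda>t. \<eta> k t *\<^sub>R (deriv \<phi> t *\<^sub>R v t)) +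
       (integral {a..b} (\<lambda>t. \<rho> k c t *\<^sub>R (\<phi> t *\<^sub>R v t)) - integral {a..b} (\<lambda>t. \<rho> k d t *\<^sub>R (\<phi> t *\<^sub>R v t))))
     \<longlonglongrightarrow> integral {c..d} (\<lambda>t. deriv \<phi> t *\<^sub>R v t) + (\<phi> c *\<^sub>R v c - \<phi> d *\<^sub>R v d)"
    unfolding \<rho>_def using cd
    by (intro tendsto_add tendsto_diff lim absolutely_integrable_continuous_real
        step_derivative_concentrates[OF H(1-3) \<phi>v(1)] \<phi>v) auto
  have R: "(\<lambda>k. - integral {a..b} (\<lambda>t. \<eta> k t *\<^sub>R (\<phi> t *\<^sub>R g t))) \<longlonglongrightarrow> - integral {c..d} (\<lambda>t. \<phi> t *\<^sub>R g t)"
    by (intro tendsto_minus lim absolutely_integrable_continuous_scaleR smooth_continuous \<phi> g)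
  \<comment> \<open>The support of \<open>\<eta> k\<close> reaches up to \<open>d + 1 / k\<close>, which has to stay below \<open>b\<close>.\<close>
  obtain K :: nat where K: "real K > 1 / (b - d)" using reals_Archimedean2 by blast
  have eq: "integral {a..b} (\<lambda>t. \<eta> k t *\<^sub>R (deriv \<phi> t *\<^sub>R v t)) +
       (integral {a..b} (\<lambda>t. \<rho> k c t *\<^sub>R (\<phi> t *\<^sub>R v t)) - integral {a..b} (\<lambda>t. \<rho> k d t *\<^sub>R (\<phi> t *\<^sub>R v t)))
     = - integral {a..b} (\<lambda>t. \<eta> k t *\<^sub>R (\<phi> t *\<^sub>R g t))" if "k \<ge> K" for k
  proof -
    have kK: "real k > 1 / (b - d)" using K that by simp
    have kpos: "real k > 0" using kK cd by (meson divide_pos_pos diff_gt_0_iff_gt less_trans zero_less_one)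
    have kd: "d + 1 / real k < b" using kK cd kpos by (simp add: field_simps)
    let ?\<psi> = "\<lambda>t. \<phi> t * \<eta> k t"
    have smooth: "smooth ?\<psi>" by (intro smooth_intros \<phi> \<eta>_smooth)
    have "{t. ?\<psi> t \<noteq> 0} \<subseteq> {c..d + 1 / real k}"
    proof (rule subsetI, rule ccontr)
      fix t assume "t \<in> {t. ?\<psi> t \<noteq> 0}" and "t \<notin> {c..d + 1 / real k}"
      then consider "t < c" | "t > d + 1 / real k" by force
      then have "\<eta> k t = 0"
      proof cases
        case 1
        then show ?thesis using kpos cd H(2) by (simp add: \<eta>_def mult_le_0_iff)
      next
        case 2
        then have "real k * (t - d) \<ge> 1" using kpos by (simp add: field_simps)
        moreover have "real k * (t - c) \<ge> real k * (t - d)" using kpos cd by simp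
        ultimately show ?thesis using H(3) by (simp add: \<eta>_def)
      qed
      then show False using \<open>t \<in> {t. ?\<psi> t \<noteq> 0}\<close> by simp
    qed
    then have cl: "closure {t. ?\<psi> t \<noteq> 0} \<subseteq> {c..d + 1 / real k}"
      by (rule closure_minimal) simp
    have "test_function a b ?\<psi>"
      unfolding test_function_def
    proof (intro conjI)
      show "\<forall>k. (deriv ^^ k) ?\<psi> differentiable_on UNIV" using smooth_iff_deriv[THEN iffD1, OF smooth] .
      show "compact (closure {t. ?\<psi> t \<noteq> 0})"
        using cl by (meson bounded_closed_interval bounded_subset closed_closure compact_eq_bounded_closed)
      show "closure {t. ?\<psi> t \<noteq> 0} \<subseteq> {a<..<b}" using cl cd kd by fastforce
    qed
    then have "set_lebesgue_integral lebesgue {a<..<b} (\<lambda>t. deriv ?\<psi> t *\<^sub>R v t) =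
        - set_lebesgue_integral lebesgue {a<..<b} (\<lambda>t. ?\<psi> t *\<^sub>R g t)"
      using wd by (simp add: is_weak_derivative_def)
    moreover have "deriv ?\<psi> t = \<eta> k t * deriv \<phi> t + (\<rho> k c t - \<rho> k d t) * \<phi> t" for t
    proof (rule DERIV_imp_deriv)
      have "(\<eta> k has_real_derivative \<rho> k c t + (- 1) * \<rho> k d t) (at t)"
        unfolding \<eta>_def \<rho>_def
        by (intro DERIV_add DERIV_cmult deriv_compose_scaled_shift H(1))
      from DERIV_mult[OF smooth_deriv(1)[OF \<phi>] this]
      show "(?\<psi> has_real_derivative \<eta> k t * deriv \<phi> t + (\<rho> k c t - \<rho> k d t) * \<phi> t) (at t)"
        by (simp add: algebra_simps)
    qed
    ultimately have "integral {a..b} (\<lambda>t. \<eta> k t *\<^sub>R (deriv \<phi> t *\<^sub>R v t) +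
         (\<rho> k c t *\<^sub>R (\<phi> t *\<^sub>R v t) - \<rho> k d t *\<^sub>R (\<phi> t *\<^sub>R v t))) =
        - integral {a..b} (\<lambda>t. \<eta> k t *\<^sub>R (\<phi> t *\<^sub>R g t))"
    proof (subst (asm) (1 2) set_lebesgue_integral_open_interval)
      show "(\<lambda>t. deriv ?\<psi> t *\<^sub>R v t) absolutely_integrable_on {a..b}"
        by (intro absolutely_integrable_continuous_real continuous_intros smooth_continuous smooth_deriv smooth v)
      show "(\<lambda>t. ?\<psi> t *\<^sub>R g t) absolutely_integrable_on {a..b}"
        by (intro absolutely_integrable_continuous_scaleR smooth_continuous smooth g)
    qed (simp add: algebra_simps)
    moreover have int: "(\<lambda>t. \<eta> k t *\<^sub>R (deriv \<phi> t *\<^sub>R v t)) integrable_on {a..b}"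
      "(\<lambda>t. \<rho> k s t *\<^sub>R (\<phi> t *\<^sub>R v t)) integrable_on {a..b}" for s
      by (intro integrable_continuous_real continuous_on_scaleR smooth_continuous \<eta>_smooth \<rho>_cont \<phi>v)+
    ultimately show ?thesis
      by (simp only: integral_add[OF int(1) integrable_diff[OF int(2) int(2)]] integral_diff[OF int(2) int(2)])
  qed
  have "\<forall>\<^sub>F k in sequentially. - integral {a..b} (\<lambda>t. \<eta> k t *\<^sub>R (\<phi> t *\<^sub>R g t)) =
      integral {a..b} (\<lambda>t. \<eta> k t *\<^sub>R (deriv \<phi> t *\<^sub>R v t)) +
       (integral {a..b} (\<lambda>t. \<rho> k c t *\<^sub>R (\<phi> t *\<^sub>R v t)) - integral {a..b} (\<lambda>t. \<rho> k d t *\<^sub>R (\<phi> t *\<^sub>R v t)))"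
    by (intro eventually_sequentiallyI[of K] eq[symmetric])
  from LIMSEQ_unique[OF L] tendsto_cong[OF this] R
  have "integral {c..d} (\<lambda>t. deriv \<phi> t *\<^sub>R v t) + (\<phi> c *\<^sub>R v c - \<phi> d *\<^sub>R v d) =
      - integral {c..d} (\<lambda>t. \<phi> t *\<^sub>R g t)"
    by blast
  then show ?thesis by (simp add: algebra_simps add_eq_0_iff)
qed

section \<open>Consequences: increments and uniqueness\<close>

text \<open>Integration by parts with \<open>\<phi> = 1\<close>; this function is smooth without being a test function.\<close>

lemma weak_derivative_increment:
  fixes v :: "real \<Rightarrow> 'a::euclidean_space"
  assumes "is_weak_derivative a b v g" "continuous_on {a..b} v" "a < c" "c < d" "d < b"
  shows "integral {c..d} g = v d - v c"
  using weak_derivative_by_parts[OF assms(1,2) smooth_intros(1)[of 1] assms(3-5)]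
  by (simp add: algebra_simps)

text \<open>The difference of two weak derivatives has integral zero over every compact subinterval, and
  almost everywhere an integrable function is the limit of its averages over intervals to the right.\<close>

lemma weak_derivative_unique_ae:
  fixes v :: "real \<Rightarrow> 'a::euclidean_space"
  assumes g: "is_weak_derivative a b v g1" "is_weak_derivative a b v g2"
    and v: "continuous_on {a..b} v"
  obtains N where "negligible N" "\<And>t. t \<in> {a<..<b} - N \<Longrightarrow> g1 t = g2 t"
proof -
  define f where "f = (\<lambda>t. if t \<in> {a<..<b} then g1 t - g2 t else 0)"
  have int: "g1 absolutely_integrable_on {a<..<b}" "g2 absolutely_integrable_on {a<..<b}"
    using g by (auto simp: is_weak_derivative_def)
  then have "f absolutely_integrable_on UNIV"
    unfolding f_def absolutely_integrable_restrict_UNIV by (rule set_integral_diff(1))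
  then have "f integrable_on cbox c d" for c d
    by (metis integrable_on_subcbox subset_UNIV set_lebesgue_integral_eq_integral(1))
  then obtain N where N: "negligible N" "\<And>x e. \<lbrakk>x \<notin> N; 0 < e\<rbrakk> \<Longrightarrow> \<exists>\<delta>>0. \<forall>h. 0 < h \<and> h < \<delta> \<longrightarrow>
      norm (integral (cbox x (x + h *\<^sub>R One)) f /\<^sub>R h ^ DIM(real) - f x) < e"
    using integrable_ccontinuous_explicit by blast
  show ?thesis
  proof (rule that[OF N(1)], rule ccontr)
    fix t assume t: "t \<in> {a<..<b} - N" and ne: "g1 t \<noteq> g2 t"
    then have ft: "norm (f t) > 0" by (simp add: f_def)
    obtain \<delta> where \<delta>: "\<delta> > 0" "\<forall>h. 0 < h \<and> h < \<delta> \<longrightarrow>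
      norm (integral (cbox t (t + h *\<^sub>R One)) f /\<^sub>R h ^ DIM(real) - f t) < norm (f t)"
      using N(2)[OF _ ft] t by blast
    define h where "h = min (\<delta> / 2) ((b - t) / 2)"
    have h: "h > 0" "h < \<delta>" "t + h < b" using \<delta>(1) t by (auto simp: h_def min_def field_simps)
    have "integral {t..t + h} f = integral {t..t + h} (\<lambda>s. g1 s - g2 s)"
      using t h by (intro integral_cong) (auto simp: f_def)
    also have "\<dots> = integral {t..t + h} g1 - integral {t..t + h} g2"
    proof (rule integral_diff)
      have "{t..t + h} \<subseteq> {a<..<b}" using t h by auto
      then show "g1 integrable_on {t..t + h}" "g2 integrable_on {t..t + h}"
        using int by (meson absolutely_integrable_on_subinterval set_lebesgue_integral_eq_integral(1))+
    qed
    also have "\<dots> = 0"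
      using weak_derivative_increment[OF g(1) v, of t "t + h"]
        weak_derivative_increment[OF g(2) v, of t "t + h"] t h by simp
    finally have "integral {t..t + h} f = 0" .
    then show False using \<delta>(2)[rule_format, of h] h by simp
  qed
qed

section \<open>Absolute continuity\<close>

lemma abs_continuousE:
  assumes "abs_continuous_interval a b u" "e > 0"
  obtains \<delta> where "\<delta> > 0" "\<And>D. finite D \<Longrightarrow> (\<forall>(c, d)\<in>D. a \<le> c \<and> c \<le> d \<and> d \<le> b) \<Longrightarrow>
      disjoint_family_on (\<lambda>(c, d). {c<..<d}) D \<Longrightarrow>
      (\<Sum>(c, d)\<in>D. d - c) < \<delta> \<Longrightarrow> (\<Sum>(c, d)\<in>D. norm (u d - u c)) < e"
  using assms(1)[unfolded abs_continuous_interval_def, THEN spec, THEN mp, OF assms(2)] that by blast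

lemma abs_continuous_imp_continuous:
  assumes "abs_continuous_interval a b u"
  shows "continuous_on {a..b} u"
proof -
  have "\<exists>\<delta>>0. \<forall>y\<in>{a..b}. dist y x < \<delta> \<longrightarrow> dist (u y) (u x) < e"
    if x: "x \<in> {a..b}" and "e > 0" for x e
  proof -
    obtain \<delta> where \<delta>: "\<delta> > 0" "\<And>D. finite D \<Longrightarrow> (\<forall>(c, d)\<in>D. a \<le> c \<and> c \<le> d \<and> d \<le> b) \<Longrightarrow>
        disjoint_family_on (\<lambda>(c, d). {c<..<d}) D \<Longrightarrow>
        (\<Sum>(c, d)\<in>D. d - c) < \<delta> \<Longrightarrow> (\<Sum>(c, d)\<in>D. norm (u d - u c)) < e"
      by (rule abs_continuousE[OF assms \<open>e > 0\<close>]) blast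
    have "dist (u y) (u x) < e" if "y \<in> {a..b}" "dist y x < \<delta>" for y
      using \<delta>(2)[of "{(min x y, max x y)}"] x that
      by (cases "x \<le> y") (auto simp: disjoint_family_on_def dist_norm norm_minus_commute)
    with \<delta>(1) show ?thesis by blast
  qed
  then show ?thesis unfolding continuous_on_iff by blast
qed

lemma abs_continuous_add:
  assumes "abs_continuous_interval a b u" "abs_continuous_interval a b w"
  shows "abs_continuous_interval a b (\<lambda>t. u t + w t)"
  unfolding abs_continuous_interval_def
proof (intro allI impI)
  fix e :: real assume "e > 0"
  then have e2: "e / 2 > 0" by simp
  obtain \<delta>1 where \<delta>1: "\<delta>1 > 0" "\<And>D. finite D \<Longrightarrow> (\<forall>(c, d)\<in>D. a \<le> c \<and> c \<le> d \<and> d \<le> b) \<Longrightarrow>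
      disjoint_family_on (\<lambda>(c, d). {c<..<d}) D \<Longrightarrow>
      (\<Sum>(c, d)\<in>D. d - c) < \<delta>1 \<Longrightarrow> (\<Sum>(c, d)\<in>D. norm (u d - u c)) < e / 2"
    by (rule abs_continuousE[OF assms(1) e2]) blast
  obtain \<delta>2 where \<delta>2: "\<delta>2 > 0" "\<And>D. finite D \<Longrightarrow> (\<forall>(c, d)\<in>D. a \<le> c \<and> c \<le> d \<and> d \<le> b) \<Longrightarrow>
      disjoint_family_on (\<lambda>(c, d). {c<..<d}) D \<Longrightarrow>
      (\<Sum>(c, d)\<in>D. d - c) < \<delta>2 \<Longrightarrow> (\<Sum>(c, d)\<in>D. norm (w d - w c)) < e / 2"
    by (rule abs_continuousE[OF assms(2) e2]) blast
  show "\<exists>\<delta>>0. \<forall>D. finite D \<longrightarrow> (\<forall>(c, d)\<in>D. a \<le> c \<and> c \<le> d \<and> d \<le> b) \<longrightarrow>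
        disjoint_family_on (\<lambda>(c, d). {c<..<d}) D \<longrightarrow>
        (\<Sum>(c, d)\<in>D. d - c) < \<delta> \<longrightarrow> (\<Sum>(c, d)\<in>D. norm (u d + w d - (u c + w c))) < e"
  proof (intro exI[of _ "min \<delta>1 \<delta>2"] conjI allI impI)
    fix D :: "(real \<times> real) set"
    assume D: "finite D" "\<forall>(c, d)\<in>D. a \<le> c \<and> c \<le> d \<and> d \<le> b"
      "disjoint_family_on (\<lambda>(c, d). {c<..<d}) D" "(\<Sum>(c, d)\<in>D. d - c) < min \<delta>1 \<delta>2"
    have "(\<Sum>(c, d)\<in>D. norm (u d + w d - (u c + w c))) \<le>
        (\<Sum>(c, d)\<in>D. norm (u d - u c) + norm (w d - w c))"
      by (intro sum_mono) (auto simp: add_diff_add norm_triangle_ineq)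
    also have "\<dots> = (\<Sum>(c, d)\<in>D. norm (u d - u c)) + (\<Sum>(c, d)\<in>D. norm (w d - w c))"
      by (simp add: sum.distrib split_def)
    also have "\<dots> < e"
      using \<delta>1(2)[OF D(1-3)] \<delta>2(2)[OF D(1-3)] D(4) by simp
    finally show "(\<Sum>(c, d)\<in>D. norm (u d + w d - (u c + w c))) < e" .
  qed (use \<delta>1 \<delta>2 in simp)
qed

lemma abs_continuous_minus:
  "abs_continuous_interval a b u \<Longrightarrow> abs_continuous_interval a b (\<lambda>t. - u t)"
  by (simp add: abs_continuous_interval_def norm_minus_commute)

lemma lipschitz_imp_abs_continuous:
  assumes "B-lipschitz_on {a..b} u"
  shows "abs_continuous_interval a b u"
  unfolding abs_continuous_interval_def
proof (intro allI impI)
  fix e :: real assume "e > 0"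
  have B: "B \<ge> 0" using assms by (rule lipschitz_on_nonneg)
  show "\<exists>\<delta>>0. \<forall>D. finite D \<longrightarrow> (\<forall>(c, d)\<in>D. a \<le> c \<and> c \<le> d \<and> d \<le> b) \<longrightarrow>
        disjoint_family_on (\<lambda>(c, d). {c<..<d}) D \<longrightarrow>
        (\<Sum>(c, d)\<in>D. d - c) < \<delta> \<longrightarrow> (\<Sum>(c, d)\<in>D. norm (u d - u c)) < e"
  proof (intro exI[of _ "e / (B + 1)"] conjI allI impI)
    show "e / (B + 1) > 0" using B \<open>e > 0\<close> by simp
    fix D :: "(real \<times> real) set"
    assume D: "\<forall>(c, d)\<in>D. a \<le> c \<and> c \<le> d \<and> d \<le> b" "(\<Sum>(c, d)\<in>D. d - c) < e / (B + 1)"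
    have "(\<Sum>(c, d)\<in>D. norm (u d - u c)) \<le> (\<Sum>(c, d)\<in>D. B * (d - c))"
    proof (rule sum_mono)
      fix I assume "I \<in> D"
      then show "(case I of (c, d) \<Rightarrow> norm (u d - u c)) \<le> (case I of (c, d) \<Rightarrow> B * (d - c))"
        using D(1) lipschitz_onD[OF assms, of "snd I" "fst I"]
        by (auto simp: split_def dist_norm)
    qed
    also have "\<dots> = B * (\<Sum>(c, d)\<in>D. d - c)" by (simp add: sum_distrib_left split_def)
    also have "\<dots> \<le> B * (e / (B + 1))" using D(2) B by (intro mult_left_mono) auto
    also have "\<dots> < e" using B \<open>e > 0\<close> by (simp add: field_simps)
    finally show "(\<Sum>(c, d)\<in>D. norm (u d - u c)) < e" .
  qed
qed

text \<open>A monotone map sends disjoint open intervals to disjoint ones, and a nonexpansive one does not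
  increase the total length. Intervals that \<open>\<kappa>\<close> collapses to a point are discarded first: they
  contribute nothing, and they are the only reason why \<open>\<kappa>\<close> may fail to be injective on the family.\<close>

lemma abs_continuous_compose_mono_nonexpansive:
  assumes u: "abs_continuous_interval a b u"
    and \<kappa>: "mono \<kappa>" "\<And>x y. x \<le> y \<Longrightarrow> \<kappa> y - \<kappa> x \<le> y - x" "\<And>x. x \<in> {a..b} \<Longrightarrow> \<kappa> x \<in> {a..b}"
  shows "abs_continuous_interval a b (\<lambda>t. u (\<kappa> t))"
  unfolding abs_continuous_interval_def
proof (intro allI impI)
  fix e :: real assume "e > 0"
  obtain \<delta> where \<delta>: "\<delta> > 0" "\<And>D. finite D \<Longrightarrow> (\<forall>(c, d)\<in>D. a \<le> c \<and> c \<le> d \<and> d \<le> b) \<Longrightarrow>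
      disjoint_family_on (\<lambda>(c, d). {c<..<d}) D \<Longrightarrow>
      (\<Sum>(c, d)\<in>D. d - c) < \<delta> \<Longrightarrow> (\<Sum>(c, d)\<in>D. norm (u d - u c)) < e"
    by (rule abs_continuousE[OF u \<open>e > 0\<close>]) blast
  show "\<exists>\<delta>>0. \<forall>D. finite D \<longrightarrow> (\<forall>(c, d)\<in>D. a \<le> c \<and> c \<le> d \<and> d \<le> b) \<longrightarrow>
        disjoint_family_on (\<lambda>(c, d). {c<..<d}) D \<longrightarrow>
        (\<Sum>(c, d)\<in>D. d - c) < \<delta> \<longrightarrow> (\<Sum>(c, d)\<in>D. norm (u (\<kappa> d) - u (\<kappa> c))) < e"
  proof (intro exI[of _ \<delta>] conjI allI impI \<delta>(1))
    fix D :: "(real \<times> real) set"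
    assume D: "finite D" "\<forall>(c, d)\<in>D. a \<le> c \<and> c \<le> d \<and> d \<le> b"
      "disjoint_family_on (\<lambda>(c, d). {c<..<d}) D" "(\<Sum>(c, d)\<in>D. d - c) < \<delta>"
    define E where "E = {I \<in> D. \<kappa> (fst I) < \<kappa> (snd I)}"
    define k where "k = (\<lambda>I :: real \<times> real. (\<kappa> (fst I), \<kappa> (snd I)))"
    have E: "finite E" "E \<subseteq> D" using D(1) by (auto simp: E_def)
    have bounds: "a \<le> fst I" "fst I \<le> snd I" "snd I \<le> b" if "I \<in> D" for I
      using D(2) that by (auto simp: split_def)
    have disj: "{\<kappa> (fst I)<..<\<kappa> (snd I)} \<inter> {\<kappa> (fst J)<..<\<kappa> (snd J)} = {}"
      if IJ: "I \<in> D" "J \<in> D" "I \<noteq> J" for I J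
    proof (rule ccontr)
      assume "{\<kappa> (fst I)<..<\<kappa> (snd I)} \<inter> {\<kappa> (fst J)<..<\<kappa> (snd J)} \<noteq> {}"
      then obtain z where "z \<in> {\<kappa> (fst I)<..<\<kappa> (snd I)} \<inter> {\<kappa> (fst J)<..<\<kappa> (snd J)}" by blast
      then have z: "\<kappa> (fst I) < z" "z < \<kappa> (snd I)" "\<kappa> (fst J) < z" "z < \<kappa> (snd J)" by auto
      have less: "x < y" if "\<kappa> x < z" "z < \<kappa> y" for x y
      proof (rule ccontr)
        assume "\<not> x < y"
        then show False using that monoD[OF \<kappa>(1), of y x] by simp
      qed
      have "max (fst I) (fst J) < min (snd I) (snd J)" using less z by auto
      then obtain y where "max (fst I) (fst J) < y" "y < min (snd I) (snd J)" using dense by blast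
      then have "y \<in> {fst I<..<snd I} \<inter> {fst J<..<snd J}" by auto
      moreover have "{fst I<..<snd I} \<inter> {fst J<..<snd J} = {}"
        using disjoint_family_onD[OF D(3) IJ] by (simp add: split_def)
      ultimately show False by blast
    qed
    have inj: "inj_on k E"
    proof (rule inj_onI, rule ccontr)
      fix I J assume "I \<in> E" "J \<in> E" "k I = k J" "I \<noteq> J"
      then have "{\<kappa> (fst I)<..<\<kappa> (snd I)} = {}" using disj[of I J] by (auto simp: E_def k_def)
      then show False using \<open>I \<in> E\<close> by (simp add: E_def)
    qed
    have "(\<Sum>(c, d)\<in>D. norm (u (\<kappa> d) - u (\<kappa> c))) = (\<Sum>(c, d)\<in>E. norm (u (\<kappa> d) - u (\<kappa> c)))"
    proof (rule sum.mono_neutral_right[OF D(1) E(2)], rule ballI)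
      fix I assume I: "I \<in> D - E"
      then have "\<kappa> (fst I) = \<kappa> (snd I)"
        using D(2) monoD[OF \<kappa>(1), of "fst I" "snd I"] by (auto simp: E_def)
      then show "(case I of (c, d) \<Rightarrow> norm (u (\<kappa> d) - u (\<kappa> c))) = 0" by (simp add: split_def)
    qed
    also have "\<dots> = (\<Sum>(c, d)\<in>k ` E. norm (u d - u c))"
      by (subst sum.reindex[OF inj]) (simp add: k_def split_def)
    also have "\<dots> < e"
    proof (rule \<delta>(2))
      show "finite (k ` E)" using E by simp
      show "\<forall>(c, d)\<in>k ` E. a \<le> c \<and> c \<le> d \<and> d \<le> b"
      proof
        fix J assume "J \<in> k ` E"
        then obtain I where I: "I \<in> D" "\<kappa> (fst I) < \<kappa> (snd I)" "J = k I"
          by (auto simp: E_def)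
        then show "case J of (c, d) \<Rightarrow> a \<le> c \<and> c \<le> d \<and> d \<le> b"
          using bounds[of I] \<kappa>(3)[of "fst I"] \<kappa>(3)[of "snd I"] by (simp add: k_def)
      qed
      show "disjoint_family_on (\<lambda>(c, d). {c<..<d}) (k ` E)"
        unfolding disjoint_family_on_def
      proof (intro ballI impI)
        fix I' J' assume "I' \<in> k ` E" "J' \<in> k ` E" "I' \<noteq> J'"
        then obtain I J where "I \<in> D" "J \<in> D" "I \<noteq> J" "I' = k I" "J' = k J"
          using E(2) by blast
        then show "(case I' of (c, d) \<Rightarrow> {c<..<d}) \<inter> (case J' of (c, d) \<Rightarrow> {c<..<d}) = {}"
          using disj[of I J] by (simp add: k_def)
      qed
      have "(\<Sum>(c, d)\<in>k ` E. d - c) = (\<Sum>(c, d)\<in>E. \<kappa> d - \<kappa> c)"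
        by (subst sum.reindex[OF inj]) (simp add: k_def split_def)
      also have "\<dots> \<le> (\<Sum>(c, d)\<in>E. d - c)"
        using bounds \<kappa>(2) by (intro sum_mono) (use E(2) in \<open>auto simp: split_def\<close>)
      also have "\<dots> \<le> (\<Sum>(c, d)\<in>D. d - c)"
        using bounds by (intro sum_mono2 D(1) E(2)) (auto simp: split_def)
      finally show "(\<Sum>(c, d)\<in>k ` E. d - c) < \<delta>" using D(4) by simp
    qed
    finally show "(\<Sum>(c, d)\<in>D. norm (u (\<kappa> d) - u (\<kappa> c))) < e" .
  qed
qed

section \<open>Replacing a curve on a subinterval\<close>

definition replace_on :: "real \<Rightarrow> real \<Rightarrow> (real \<Rightarrow> 'b) \<Rightarrow> (real \<Rightarrow> 'b) \<Rightarrow> real \<Rightarrow> 'b" where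
  "replace_on c d p v t = (if t \<in> {c..d} then p t else v t)"

lemma replace_on_integral:
  fixes f q :: "real \<Rightarrow> 'a::euclidean_space"
  assumes f: "f absolutely_integrable_on {a..b}" and q: "q absolutely_integrable_on {c..d}"
    and sub: "{c..d} \<subseteq> {a..b}"
  shows "replace_on c d q f absolutely_integrable_on {a..b}"
    and "integral {a..b} (replace_on c d q f) = integral {a..b} f + (integral {c..d} q - integral {c..d} f)"
proof -
  define r where "r = (\<lambda>t. if t \<in> {c..d} then q t - f t else 0)"
  have fcd: "f absolutely_integrable_on {c..d}"
    using absolutely_integrable_on_subinterval[OF f sub] .
  have "(\<lambda>t. q t - f t) absolutely_integrable_on {c..d}"
    by (intro set_integral_diff q fcd)
  then have "r absolutely_integrable_on UNIV"
    unfolding r_def absolutely_integrable_restrict_UNIV .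
  then have r: "r absolutely_integrable_on {a..b}"
    by (rule absolutely_integrable_on_subinterval) simp
  have eq: "replace_on c d q f = (\<lambda>t. f t + r t)" by (auto simp: replace_on_def r_def)
  show "replace_on c d q f absolutely_integrable_on {a..b}"
    unfolding eq by (intro set_integral_add f r)
  have "integral {a..b} (replace_on c d q f) = integral {a..b} f + integral {a..b} r"
    unfolding eq by (intro integral_add set_lebesgue_integral_eq_integral(1) f r)
  also have "integral {a..b} r = integral ({c..d} \<inter> {a..b}) (\<lambda>t. q t - f t)"
    unfolding r_def by (rule integral_restrict_Int)
  also have "{c..d} \<inter> {a..b} = {c..d}" using sub by blast
  also have "integral {c..d} (\<lambda>t. q t - f t) = integral {c..d} q - integral {c..d} f"
    by (intro integral_diff set_lebesgue_integral_eq_integral(1) q fcd)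
  finally show "integral {a..b} (replace_on c d q f) =
      integral {a..b} f + (integral {c..d} q - integral {c..d} f)" .
qed

lemma norm_increment_le_derivative_bound:
  fixes p :: "real \<Rightarrow> 'a::real_normed_vector"
  assumes p: "\<And>t. t \<in> {c..d} \<Longrightarrow> (p has_vector_derivative p' t) (at t within {c..d})"
    and B: "\<And>t. t \<in> {c..d} \<Longrightarrow> norm (p' t) \<le> B" and xy: "x \<in> {c..d}" "y \<in> {c..d}"
  shows "norm (p y - p x) \<le> B * \<bar>y - x\<bar>"
proof -
  have B0: "0 \<le> B" using order_trans[OF norm_ge_zero B[OF xy(1)]] .
  have "onorm (\<lambda>h. h *\<^sub>R p' t) \<le> B" if "t \<in> {c..d}" for t
    using mult_left_mono[OF B[OF that] abs_ge_zero] B0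
    by (intro onorm_bound) (auto simp: mult.commute)
  then have "norm (p y - p x) \<le> B * norm (y - x)"
    using p xy unfolding has_vector_derivative_def
    by (intro differentiable_bound[of "{c..d}" p "\<lambda>t h. h *\<^sub>R p' t"]) auto
  then show ?thesis by simp
qed

text \<open>A \<open>C\<^sup>1\<close> curve \<open>p\<close> on \<open>[c, d]\<close> that can be substituted for \<open>v\<close> without creating jumps.\<close>

locale piece_replacement =
  fixes a b c d :: real and v g p p' :: "real \<Rightarrow> 'a::euclidean_space"
  assumes order: "a < c" "c < d" "d < b"
    and v: "v \<in> W11 a b" and g: "is_weak_derivative a b v g"
    and p: "\<And>t. t \<in> {c..d} \<Longrightarrow> (p has_vector_derivative p' t) (at t within {c..d})"
    and p': "continuous_on {c..d} p'"
    and ends: "p c = v c" "p d = v d"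
begin

lemma continuous: "continuous_on {a..b} v" "continuous_on {c..d} p"
proof -
  show "continuous_on {a..b} v"
    using v by (simp add: W11_def abs_continuous_imp_continuous)
  show "continuous_on {c..d} p"
    using p by (meson continuous_on_eq_continuous_within has_vector_derivative_continuous)
qed

lemma cd_subset: "{c..d} \<subseteq> {a..b}"
  using order by auto

text \<open>Both \<open>p\<close> and \<open>v\<close> satisfy integration by parts on \<open>[c, d]\<close>, with the same boundary terms.
  Substituting one for the other therefore changes \<open>\<integral> \<phi>' u\<close> and \<open>- \<integral> \<phi> u'\<close> by the same amount.\<close>

lemma weak_derivative_replace_on: "is_weak_derivative a b (replace_on c d p v) (replace_on c d p' g)"
  unfolding is_weak_derivative_def
proof (intro conjI allI impI)
  have gab: "g absolutely_integrable_on {a..b}"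
    using g by (simp add: is_weak_derivative_def absolutely_integrable_on_open_interval_iff)
  show "replace_on c d p' g absolutely_integrable_on {a<..<b}"
    unfolding absolutely_integrable_on_open_interval_iff
    by (intro replace_on_integral gab absolutely_integrable_continuous_real p' cd_subset)
  fix \<phi> assume test: "test_function a b \<phi>"
  then have \<phi>: "smooth \<phi>" by (simp add: test_function_def smooth_iff_deriv)
  note cont = smooth_continuous[OF \<phi>] smooth_continuous[OF smooth_deriv(2)[OF \<phi>]]
  have int: "(\<lambda>t. deriv \<phi> t *\<^sub>R v t) absolutely_integrable_on {a..b}"
    "(\<lambda>t. \<phi> t *\<^sub>R g t) absolutely_integrable_on {a..b}"
    "(\<lambda>t. deriv \<phi> t *\<^sub>R p t) absolutely_integrable_on {c..d}"
    "(\<lambda>t. \<phi> t *\<^sub>R p' t) absolutely_integrable_on {c..d}"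
    by (intro absolutely_integrable_continuous_real continuous_on_scaleR
        absolutely_integrable_continuous_scaleR cont continuous p' gab)+
  have spl: "(\<lambda>t. deriv \<phi> t *\<^sub>R replace_on c d p v t) =
      replace_on c d (\<lambda>t. deriv \<phi> t *\<^sub>R p t) (\<lambda>t. deriv \<phi> t *\<^sub>R v t)"
    "(\<lambda>t. \<phi> t *\<^sub>R replace_on c d p' g t) = replace_on c d (\<lambda>t. \<phi> t *\<^sub>R p' t) (\<lambda>t. \<phi> t *\<^sub>R g t)"
    by (auto simp: replace_on_def)
  have "((\<lambda>t. \<phi> t *\<^sub>R p' t + deriv \<phi> t *\<^sub>R p t) has_integral \<phi> d *\<^sub>R p d - \<phi> c *\<^sub>R p c) {c..d}"
    using order(2) by (intro fundamental_theorem_of_calculus has_vector_derivative_scaleR p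
        has_field_derivative_at_within[OF smooth_deriv(1)[OF \<phi>]]) auto
  then have "integral {c..d} (\<lambda>t. \<phi> t *\<^sub>R p' t) + integral {c..d} (\<lambda>t. deriv \<phi> t *\<^sub>R p t) =
      \<phi> d *\<^sub>R v d - \<phi> c *\<^sub>R v c"
    using integral_add[OF int(4,3)[THEN set_lebesgue_integral_eq_integral(1)]] ends
    by (simp add: integral_unique)
  moreover have "integral {c..d} (\<lambda>t. \<phi> t *\<^sub>R g t) + integral {c..d} (\<lambda>t. deriv \<phi> t *\<^sub>R v t) =
      \<phi> d *\<^sub>R v d - \<phi> c *\<^sub>R v c"
    using weak_derivative_by_parts[OF g continuous(1) \<phi> order] by simp
  moreover have "P - Q = - (x - y)" if "x + P = z" "y + Q = z" for x y z P Q :: 'a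
  proof -
    have "P = z - x" "Q = z - y" using that by (metis add_diff_cancel_left')+
    then show ?thesis by simp
  qed
  ultimately have swap: "integral {c..d} (\<lambda>t. deriv \<phi> t *\<^sub>R p t) - integral {c..d} (\<lambda>t. deriv \<phi> t *\<^sub>R v t) =
      - (integral {c..d} (\<lambda>t. \<phi> t *\<^sub>R p' t) - integral {c..d} (\<lambda>t. \<phi> t *\<^sub>R g t))"
    by blast
  have "set_lebesgue_integral lebesgue {a<..<b} (\<lambda>t. deriv \<phi> t *\<^sub>R v t) =
      - set_lebesgue_integral lebesgue {a<..<b} (\<lambda>t. \<phi> t *\<^sub>R g t)"
    using g test unfolding is_weak_derivative_def by blast
  then have whole: "integral {a..b} (\<lambda>t. deriv \<phi> t *\<^sub>R v t) = - integral {a..b} (\<lambda>t. \<phi> t *\<^sub>R g t)"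
    by (simp only: set_lebesgue_integral_open_interval int)
  note repl = replace_on_integral[OF int(1,3) cd_subset] replace_on_integral[OF int(2,4) cd_subset]
  show "set_lebesgue_integral lebesgue {a<..<b} (\<lambda>t. deriv \<phi> t *\<^sub>R replace_on c d p v t) =
      - set_lebesgue_integral lebesgue {a<..<b} (\<lambda>t. \<phi> t *\<^sub>R replace_on c d p' g t)"
    unfolding spl set_lebesgue_integral_open_interval[OF repl(1)]
      set_lebesgue_integral_open_interval[OF repl(3)] repl(2,4) whole swap minus_add_distrib ..
qed

text \<open>With \<open>\<kappa>\<close> the projection of the line onto \<open>[c, d]\<close>, the new curve is \<open>v + p \<circ> \<kappa> - v \<circ> \<kappa>\<close> on the whole
  line, since \<open>p\<close> and \<open>v\<close> agree at \<open>c\<close> and \<open>d\<close>. Each of the three terms is absolutely continuous,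
  the middle one because it is Lipschitz.\<close>

lemma replace_on_in_W11: "replace_on c d p v \<in> W11 a b"
proof -
  define \<kappa> where "\<kappa> = (\<lambda>t. max c (min d t))"
  have \<kappa>: "mono \<kappa>" "\<kappa> t \<in> {c..d}" for t
    using order(2) unfolding \<kappa>_def by (auto intro!: monoI max.mono min.mono)
  have \<kappa>_nonexpansive: "\<kappa> y - \<kappa> x \<le> y - x" if "x \<le> y" for x y
    using that order(2) unfolding \<kappa>_def by linarith
  obtain B where B: "\<And>t. t \<in> {c..d} \<Longrightarrow> norm (p' t) \<le> B"
    using compact_imp_bounded[OF compact_continuous_image[OF p' compact_Icc]]
    unfolding bounded_iff by blast
  have "B \<ge> 0" using order_trans[OF norm_ge_zero B[of c]] order(2) by simp
  have "B-lipschitz_on {a..b} (\<lambda>t. p (\<kappa> t))"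
  proof (rule lipschitz_onI)
    fix x y
    have "\<bar>\<kappa> x - \<kappa> y\<bar> \<le> \<bar>x - y\<bar>"
      using \<kappa>_nonexpansive[of x y] \<kappa>_nonexpansive[of y x] monoD[OF \<kappa>(1), of x y] monoD[OF \<kappa>(1), of y x]
      by linarith
    then have "B * \<bar>\<kappa> x - \<kappa> y\<bar> \<le> B * \<bar>x - y\<bar>" using \<open>B \<ge> 0\<close> by (rule mult_left_mono)
    then show "dist (p (\<kappa> x)) (p (\<kappa> y)) \<le> B * dist x y"
      using norm_increment_le_derivative_bound[OF p B \<kappa>(2) \<kappa>(2), of x y]
      by (simp add: dist_norm norm_minus_commute)
  qed fact
  moreover have "abs_continuous_interval a b (\<lambda>t. v (\<kappa> t))"
  proof (rule abs_continuous_compose_mono_nonexpansive[OF _ \<kappa>(1) \<kappa>_nonexpansive])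
    show "abs_continuous_interval a b v" using v by (simp add: W11_def)
    show "\<kappa> t \<in> {a..b}" for t using \<kappa>(2) cd_subset by blast
  qed
  moreover have "abs_continuous_interval a b v" using v by (simp add: W11_def)
  ultimately have "abs_continuous_interval a b (\<lambda>t. v t + (p (\<kappa> t) + - v (\<kappa> t)))"
    by (metis abs_continuous_add abs_continuous_minus lipschitz_imp_abs_continuous)
  moreover have "(\<lambda>t. v t + (p (\<kappa> t) + - v (\<kappa> t))) = replace_on c d p v"
  proof
    fix t
    consider "t < c" | "t \<in> {c..d}" | "d < t" by force
    then show "v t + (p (\<kappa> t) + - v (\<kappa> t)) = replace_on c d p v t"
      by cases (use ends order(2) in \<open>simp_all add: replace_on_def \<kappa>_def\<close>)
  qed
  ultimately have ac: "abs_continuous_interval a b (replace_on c d p v)" by metis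
  then have "replace_on c d p v absolutely_integrable_on {a<..<b}"
    unfolding absolutely_integrable_on_open_interval_iff
    by (intro absolutely_integrable_continuous_real abs_continuous_imp_continuous)
  with ac weak_derivative_replace_on show ?thesis unfolding W11_def by blast
qed

end

lemma is_weak_derivative_weak_deriv:
  "is_weak_derivative a b u g \<Longrightarrow> is_weak_derivative a b u (weak_deriv a b u)"
  unfolding weak_deriv_def by (rule someI[of "is_weak_derivative a b u"])

text \<open>Since \<open>weak_deriv\<close> is an arbitrary choice, the Lagrangian of the new curve is known only almost
  everywhere; that suffices for its integral.\<close>

lemma replace_on_action:
  fixes L :: "real \<times> 'a \<times> 'a::euclidean_space \<Rightarrow> real"
  assumes S: "piece_replacement a b c d v (weak_deriv a b v) p p'"
    and L: "continuous_on ({a..b} \<times> UNIV \<times> UNIV) L"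
    and Lv: "lagrangian L a b v absolutely_integrable_on {a..b}"
  shows "lagrangian L a b (replace_on c d p v) absolutely_integrable_on {a..b}"
    and "action L a b (replace_on c d p v) - action L a b v =
      integral {c..d} (\<lambda>t. L (t, p t, p' t)) - integral {c..d} (lagrangian L a b v)"
proof -
  interpret piece_replacement a b c d v "weak_deriv a b v" p p' by (rule S)
  let ?u = "replace_on c d p v" and ?q = "\<lambda>t. L (t, p t, p' t)"
  have "continuous_on {c..d} ?q"
    using cd_subset
    by (intro continuous_on_compose2[OF L] continuous_intros continuous p') auto
  then have q: "?q absolutely_integrable_on {c..d}" by (rule absolutely_integrable_continuous_real)
  have "is_weak_derivative a b ?u (weak_deriv a b ?u)"
    using weak_derivative_replace_on by (rule is_weak_derivative_weak_deriv)
  moreover have "continuous_on {a..b} ?u"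
    using replace_on_in_W11 by (simp add: W11_def abs_continuous_imp_continuous)
  ultimately obtain N where N: "negligible N"
    "\<And>t. t \<in> {a<..<b} - N \<Longrightarrow> weak_deriv a b ?u t = replace_on c d p' (weak_deriv a b v) t"
    using weak_derivative_unique_ae[OF _ weak_derivative_replace_on] by metis
  have neg: "negligible (N \<union> {a, b})" using N(1) by (simp add: negligible_Un)
  have ae: "lagrangian L a b ?u t = replace_on c d ?q (lagrangian L a b v) t"
    if "t \<in> {a..b} - (N \<union> {a, b})" for t
    using N(2)[of t] that by (auto simp: lagrangian_def replace_on_def)
  show Lu: "lagrangian L a b ?u absolutely_integrable_on {a..b}"
    using replace_on_integral(1)[OF Lv q cd_subset] neg ae by (rule absolutely_integrable_spike)
  have "integral {a..b} (lagrangian L a b ?u) = integral {a..b} (replace_on c d ?q (lagrangian L a b v))"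
    by (rule integral_spike[OF neg ae, symmetric])
  then have "integral {a..b} (lagrangian L a b ?u) - integral {a..b} (lagrangian L a b v) =
      integral {c..d} ?q - integral {c..d} (lagrangian L a b v)"
    unfolding replace_on_integral(2)[OF Lv q cd_subset] by simp
  then show "action L a b ?u - action L a b v = integral {c..d} ?q - integral {c..d} (lagrangian L a b v)"
    unfolding action_def set_lebesgue_integral_eq_integral(2)[OF Lu]
      set_lebesgue_integral_eq_integral(2)[OF Lv] .
qed

section \<open>Choosing the interval and the replacement\<close>

lemma integral_equipartition_le_average:
  fixes f :: "real \<Rightarrow> real" and N :: nat
  assumes f: "f integrable_on {\<alpha>..\<beta>}" and "\<alpha> < \<beta>" "N > 0"
  defines "h \<equiv> (\<beta> - \<alpha>) / real N"
  obtains c where "\<alpha> \<le> c" "c + h \<le> \<beta>" "integral {c..c + h} f \<le> integral {\<alpha>..\<beta>} f / real N"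
proof -
  have h: "h > 0" "\<alpha> + real N * h = \<beta>" using assms(2,3) by (simp_all add: h_def)
  have le: "\<alpha> + real i * h \<le> \<beta>" if "i \<le> N" for i
  proof -
    have "real i * h \<le> real N * h" using that h(1) by (intro mult_right_mono) auto
    then show ?thesis using h(2) by linarith
  qed
  have sum: "(\<Sum>i<n. integral {\<alpha> + real i * h..\<alpha> + real i * h + h} f) = integral {\<alpha>..\<alpha> + real n * h} f"
    if "n \<le> N" for n
    using that
  proof (induction n)
    case (Suc n)
    have "integral {\<alpha>..\<alpha> + real n * h} f + integral {\<alpha> + real n * h..\<alpha> + real (Suc n) * h} f =
        integral {\<alpha>..\<alpha> + real (Suc n) * h} f"
    proof (rule Henstock_Kurzweil_Integration.integral_combine)
      show "f integrable_on {\<alpha>..\<alpha> + real (Suc n) * h}"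
        using le[OF Suc.prems] by (intro integrable_on_subinterval[OF f]) auto
    qed (use h in \<open>auto simp: distrib_right\<close>)
    moreover have "(\<Sum>i<n. integral {\<alpha> + real i * h..\<alpha> + real i * h + h} f) = integral {\<alpha>..\<alpha> + real n * h} f"
      using Suc by simp
    moreover have "\<alpha> + real (Suc n) * h = \<alpha> + real n * h + h" by (simp add: distrib_right)
    ultimately show ?case by (simp add: add.assoc)
  qed simp
  have "\<exists>i<N. integral {\<alpha> + real i * h..\<alpha> + real i * h + h} f \<le> integral {\<alpha>..\<beta>} f / real N"
  proof (rule ccontr)
    assume "\<not> ?thesis"
    then have "(\<Sum>i<N. integral {\<alpha>..\<beta>} f / real N) <
        (\<Sum>i<N. integral {\<alpha> + real i * h..\<alpha> + real i * h + h} f)"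
      using \<open>N > 0\<close> by (intro sum_strict_mono) (auto simp: not_le)
    then show False using sum[of N] h \<open>N > 0\<close> by simp
  qed
  then obtain i where i: "i < N" "integral {\<alpha> + real i * h..\<alpha> + real i * h + h} f \<le> integral {\<alpha>..\<beta>} f / real N"
    by blast
  show ?thesis
    using that[OF _ _ i(2)] le[of "Suc i"] i(1) h by (simp add: algebra_simps)
qed

text \<open>The choice of \<open>[c, d]\<close> and \<open>p\<close> described at the beginning. The derivative bound \<open>R\<close> and the
  bound \<open>M\<close> of \<open>\<bar>L\<bar>\<close> are fixed before the number \<open>N\<close> of parts, which depends on \<open>M\<close>.\<close>

lemma local_perturbation_small_action_change:
  fixes L :: "real \<times> 'a \<times> 'a::euclidean_space \<Rightarrow> real"
  assumes L: "continuous_on ({a..b} \<times> UNIV \<times> UNIV) L"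
    and v: "v \<in> W11 a b"
    and Lv: "lagrangian L a b v absolutely_integrable_on {a..b}"
    and U: "open U" "U \<noteq> {}" "U \<subseteq> {a<..<b}"
    and "\<epsilon> > 0"
  shows "\<exists>u \<in> admissible a b (v a) (v b).
           {} \<noteq> {t \<in> {a..b}. u t \<noteq> v t} \<and> {t \<in> {a..b}. u t \<noteq> v t} \<subseteq> U \<and>
           lagrangian L a b u absolutely_integrable_on {a..b} \<and>
           \<bar>action L a b u - action L a b v\<bar> \<le> \<epsilon>"
proof -
  define g where "g = weak_deriv a b v"
  have wd: "is_weak_derivative a b v g"
    using v is_weak_derivative_weak_deriv by (auto simp: W11_def g_def)
  have gab: "g absolutely_integrable_on {a..b}"
    using wd by (simp add: is_weak_derivative_def absolutely_integrable_on_open_interval_iff)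
  have vcont: "continuous_on {a..b} v"
    using v by (simp add: W11_def abs_continuous_imp_continuous)
  obtain x r where xr: "r > 0" "cball x r \<subseteq> U" using U open_contains_cball by blast
  define \<alpha> \<beta> where "\<alpha> = x - r" and "\<beta> = x + r"
  have \<alpha>\<beta>: "\<alpha> < \<beta>" "{\<alpha>..\<beta>} \<subseteq> U"
    using xr by (auto simp: \<alpha>_def \<beta>_def cball_eq_atLeastAtMost)
  moreover have "\<alpha> \<in> {\<alpha>..\<beta>}" "\<beta> \<in> {\<alpha>..\<beta>}" using \<alpha>\<beta>(1) by auto
  ultimately have "\<alpha> \<in> {a<..<b}" "\<beta> \<in> {a<..<b}" using U(3) by blast+
  then have ab: "a < \<alpha>" "\<beta> < b" by auto
  define F where "F = (\<lambda>t. norm (g t) + \<bar>lagrangian L a b v t\<bar>)"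
  define K where "K = integral {\<alpha>..\<beta>} F"
  have int_norm: "(\<lambda>t. norm (g t)) integrable_on {c..d}"
      "(\<lambda>t. \<bar>lagrangian L a b v t\<bar>) integrable_on {c..d}"
      "g integrable_on {c..d}" "lagrangian L a b v integrable_on {c..d}"
    if "{c..d} \<subseteq> {a..b}" for c d
    using absolutely_integrable_on_subinterval[OF gab that]
      absolutely_integrable_on_subinterval[OF Lv that]
    by (auto simp: absolutely_integrable_on_def)
  have F: "F integrable_on {\<alpha>..\<beta>}"
    unfolding F_def using ab by (intro integrable_add int_norm) auto
  have K: "K \<ge> 0" unfolding K_def by (intro integral_nonneg F) (auto simp: F_def)
  \<comment> \<open>The slope \<open>K / (\<beta> - \<alpha>)\<close> of any chord used below, plus 1 for the slope of the arch.\<close>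
  define R where "R = K / (\<beta> - \<alpha>) + 1"
  have R: "R > 0" using K \<alpha>\<beta>(1) by (simp add: R_def add_nonneg_pos)
  obtain V where V: "\<And>t. t \<in> {a..b} \<Longrightarrow> norm (v t) \<le> V"
    using compact_imp_bounded[OF compact_continuous_image[OF vcont compact_Icc]]
    unfolding bounded_iff by blast
  define Q where "Q = {a..b} \<times> cball (0::'a) (V + R * (b - a)) \<times> cball (0::'a) R"
  have "compact (L ` Q)"
    unfolding Q_def
    by (intro compact_continuous_image continuous_on_subset[OF L] compact_Times) auto
  then obtain M where M: "M > 0" "\<And>z. z \<in> Q \<Longrightarrow> \<bar>L z\<bar> \<le> M"
    by (metis bounded_pos compact_imp_bounded imageI real_norm_def)
  obtain N :: nat where N': "(M * (\<beta> - \<alpha>) + K) / \<epsilon> < real N" using reals_Archimedean2 by blast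
  have "0 < (M * (\<beta> - \<alpha>) + K) / \<epsilon>"
    using M(1) K \<alpha>\<beta>(1) \<open>\<epsilon> > 0\<close> by (simp add: add_pos_nonneg)
  with N' have "0 < real N" by linarith
  moreover have "M * (\<beta> - \<alpha>) + K \<le> \<epsilon> * real N"
    using N' \<open>\<epsilon> > 0\<close> by (simp add: pos_divide_less_eq mult.commute)
  ultimately have N: "N > 0" "(M * (\<beta> - \<alpha>) + K) / real N \<le> \<epsilon>"
    by (simp_all add: pos_divide_le_eq)
  define h where "h = (\<beta> - \<alpha>) / real N"
  have h: "h > 0" using \<alpha>\<beta>(1) N(1) by (simp add: h_def)
  obtain c where c: "\<alpha> \<le> c" "c + h \<le> \<beta>" "integral {c..c + h} F \<le> K / real N"
    using integral_equipartition_le_average[OF F \<alpha>\<beta>(1) N(1)] unfolding h_def K_def by blast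
  define d where "d = c + h"
  have order: "a < c" "c < d" "d < b" using ab c h by (auto simp: d_def)
  have sub: "{c..d} \<subseteq> {a..b}" and subU: "{c..d} \<subseteq> U" using order \<alpha>\<beta>(2) c by (auto simp: d_def)
  have split: "integral {c..d} (\<lambda>t. norm (g t)) + integral {c..d} (\<lambda>t. \<bar>lagrangian L a b v t\<bar>) \<le> K / real N"
    using c(3) integral_add[OF int_norm(1,2)[OF sub]] by (simp add: F_def d_def)
  have pos: "0 \<le> integral {c..d} (\<lambda>t. norm (g t))" "0 \<le> integral {c..d} (\<lambda>t. \<bar>lagrangian L a b v t\<bar>)"
    by (intro integral_nonneg int_norm sub; simp)+
  have "norm (v d - v c) \<le> integral {c..d} (\<lambda>t. norm (g t))"
    unfolding weak_derivative_increment[OF wd vcont order, symmetric]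
    by (intro integral_norm_bound_integral int_norm sub) auto
  also have "\<dots> \<le> K / real N" using split pos by linarith
  also have "\<dots> = K / (\<beta> - \<alpha>) * h" using \<alpha>\<beta>(1) by (simp add: h_def)
  finally have incr: "norm (v d - v c) \<le> K / (\<beta> - \<alpha>) * h" .
  have Lv_small: "\<bar>integral {c..d} (lagrangian L a b v)\<bar> \<le> K / real N"
  proof -
    have "norm (integral {c..d} (lagrangian L a b v)) \<le> integral {c..d} (\<lambda>t. \<bar>lagrangian L a b v t\<bar>)"
      by (intro integral_norm_bound_integral int_norm sub) auto
    then show ?thesis using split pos by simp
  qed
  define q where "q = (v d - v c) /\<^sub>R h"
  have "norm q = norm (v d - v c) / h" using h by (simp add: q_def divide_inverse mult.commute)
  then have q: "norm q \<le> K / (\<beta> - \<alpha>)" using incr h by (simp add: pos_divide_le_eq)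
  obtain e :: 'a where e: "norm e = 1" using norm_Basis nonempty_Basis by blast
  \<comment> \<open>\<open>p 0\<close> is the chord; \<open>p 1\<close> adds an arch whose slope is at most 1, thanks to the factor \<open>1 / h\<close>.\<close>
  define p where "p = (\<lambda>s t. v c + (t - c) *\<^sub>R q + (s * ((t - c) * (d - t)) / h) *\<^sub>R e)"
  define p' where "p' = (\<lambda>s t. q + (s * (c + d - 2 * t) / h) *\<^sub>R e)"
  define m where "m = (c + d) / 2"
  have m: "c < m" "m < d" using order(2) by (simp_all add: m_def)
  have "p 1 m - p 0 m = ((m - c) * (d - m) / h) *\<^sub>R e" by (simp add: p_def)
  moreover have "(m - c) * (d - m) / h > 0" "e \<noteq> 0" using m h e by auto
  ultimately have "p 1 m - p 0 m \<noteq> 0" by (metis less_irrefl scaleR_eq_0_iff)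
  then obtain s where s: "s = 0 \<or> s = 1" "p s m \<noteq> v m" by (metis right_minus_eq)
  have p'_bound: "norm (p' s t) \<le> R" if "t \<in> {c..d}" for t
  proof -
    have "\<bar>c + d - 2 * t\<bar> \<le> h" using that by (simp add: d_def abs_le_iff)
    then have "\<bar>s * (c + d - 2 * t) / h\<bar> \<le> 1" using s(1) h by auto
    then have "norm ((s * (c + d - 2 * t) / h) *\<^sub>R e) \<le> 1" using e by simp
    then show ?thesis
      using q norm_triangle_ineq[of q "(s * (c + d - 2 * t) / h) *\<^sub>R e"] by (simp add: p'_def R_def)
  qed
  have p_deriv: "(p s has_vector_derivative p' s t) (at t within S)" for t S
  proof -
    have A: "((\<lambda>t. t - c) has_real_derivative 1) (at t within S)"
      by (auto intro!: derivative_eq_intros)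
    have B: "((\<lambda>t. s * ((t - c) * (d - t)) / h) has_real_derivative s * (c + d - 2 * t) / h) (at t within S)"
      using h by (auto intro!: derivative_eq_intros simp: field_simps)
    show ?thesis
      using has_vector_derivative_add[OF has_vector_derivative_add[OF has_vector_derivative_const
            has_vector_derivative_scaleR[OF A has_vector_derivative_const]]
          has_vector_derivative_scaleR[OF B has_vector_derivative_const], of "v c" q e]
      by (simp add: p_def p'_def)
  qed
  interpret piece_replacement a b c d v g "p s" "p' s"
  proof
    show "p s c = v c" by (simp add: p_def)
    show "p s d = v d" using h by (simp add: p_def q_def d_def)
    show "continuous_on {c..d} (p' s)" unfolding p'_def using h by (intro continuous_intros) auto
  qed (use order v wd p_deriv in auto)
  have p_bound: "norm (p s t) \<le> V + R * (b - a)" if "t \<in> {c..d}" for t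
  proof -
    have "norm (p s t - p s c) \<le> R * \<bar>t - c\<bar>"
      using that order by (intro norm_increment_le_derivative_bound[OF p p'_bound]) auto
    also have "\<dots> \<le> R * (b - a)" using that order R by (intro mult_left_mono) auto
    finally have "norm (p s t - v c) \<le> R * (b - a)" using ends(1) by simp
    moreover have "norm (v c) \<le> V" using V order by simp
    ultimately show ?thesis using norm_triangle_ineq[of "p s t - v c" "v c"] by simp
  qed
  have Lp_small: "\<bar>integral {c..d} (\<lambda>t. L (t, p s t, p' s t))\<bar> \<le> M * h"
  proof -
    have "continuous_on {c..d} (\<lambda>t. L (t, p s t, p' s t))"
      using cd_subset by (intro continuous_on_compose2[OF L] continuous_intros continuous p') auto
    then have "norm (integral {c..d} (\<lambda>t. L (t, p s t, p' s t))) \<le> M * (d - c)"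
      using order M(2) p_bound p'_bound sub by (intro integral_bound) (auto simp: Q_def)
    then show ?thesis by (simp add: d_def)
  qed
  let ?u = "replace_on c d (p s) v"
  have S: "piece_replacement a b c d v (weak_deriv a b v) (p s) (p' s)"
    using piece_replacement_axioms by (simp add: g_def)
  have "\<bar>action L a b ?u - action L a b v\<bar> \<le> M * h + K / real N"
    unfolding replace_on_action(2)[OF S L Lv] using Lp_small Lv_small by linarith
  also have "\<dots> = (M * (\<beta> - \<alpha>) + K) / real N" by (simp add: h_def add_divide_distrib)
  also have "\<dots> \<le> \<epsilon>" by (rule N(2))
  finally have act: "\<bar>action L a b ?u - action L a b v\<bar> \<le> \<epsilon>" .
  have "?u \<in> admissible a b (v a) (v b)"
    using replace_on_in_W11 order by (simp add: admissible_def replace_on_def)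
  moreover have "m \<in> {t \<in> {a..b}. ?u t \<noteq> v t}"
    using s(2) order m by (simp add: replace_on_def)
  moreover have "{t \<in> {a..b}. ?u t \<noteq> v t} \<subseteq> U"
    using subU by (auto simp: replace_on_def)
  ultimately show ?thesis
    using replace_on_action(1)[OF S L Lv] act by blast
qed

theorem theorem15:
  fixes a b \<epsilon> :: real
    and L :: "real \<times> (real ^ 'n) \<times> (real ^ 'n) \<Rightarrow> real"
    and v :: "real \<Rightarrow> real ^ 'n"
    and U :: "real set"
  assumes "continuous_on ({a..b} \<times> UNIV \<times> UNIV) L"
    and "v \<in> W11 a b"
    and "lagrangian L a b v absolutely_integrable_on {a..b}"
    and "open U" and "U \<noteq> {}" and "U \<subseteq> {a<..<b}"
    and "\<epsilon> > 0"
  shows "\<exists>u \<in> admissible a b (v a) (v b).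
           {} \<noteq> {t \<in> {a..b}. u t \<noteq> v t} \<and> {t \<in> {a..b}. u t \<noteq> v t} \<subseteq> U \<and>
           lagrangian L a b u absolutely_integrable_on {a..b} \<and>
           \<bar>action L a b u - action L a b v\<bar> \<le> \<epsilon>"
  using assms by (rule local_perturbation_small_action_change)

end
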